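(* Consider a network with routes of length one carrying peak-rate constrained elastic traffic, with $\rho_i=\lambda_i/\mu_i$ satisfying the stability condition $\sum_{i\in I(J')}\rho_i<C(J')$ for all $J'\in\mathscr{SC}(J)$. A sufficient condition for the existence of an equilibrium point (of the fluid limit) in complete resource pooling is $$\sum_{i\in I(J'^c)^c}\rho_i>C(J')\qquad\text{for all }J'\in\mathscr{C}(J),\ J'\ne J.$$
   Context: Network: $I$ is a finite nonempty set of users (flow types), $J$ a finite set of resources, resource $j$ has capacity $C_j>0$, and user $i$ can use exactly the resources in the nonempty set $J(i)\subseteq J$ (each route is a single resource). Type $i$ flows have arrival rate $\lambda_i>0$, mean size $1/\mu_i$ with $\mu_i>0$, and peak rate $r_i>0$. Optimal allocation: let $U$ be a strictly concave, strictly increasing, differentiable utility function common to all users. For $n=(n_i)_{i\in I}$, $x(n)=(x_i(n))_{i\in I}$ is the solution of: maximize $\sum_{i} n_iU(x_i)$ subject to $\sum_{i: j\in J(i)} n_ix_i^j\le C_j$ for all $j\in J$; $\sum_{j\in J(i)}x_i^j=x_i$ for all $i$; $x_i^j\ge 0$ for $j\in J(i)$. Fluid limit: $n_i'(t)=\lambda_i-\mu_in_i(t)\min\{x_i(n(t)),r_i\}$; an equilibrium point is a vector $\hat n$ of positive reals with $\hat n_i\min\{x_i(\hat n),r_i\}=\rho_i$ for all $i\in I$. Complete resource pooling: a state $n$ is in complete resource pooling if there is a neighbourhood of $n$ such that for each $n'$ in it, $x_i(n')=\sum_{j\in J}C_j/\sum_{i'\in I}n'_{i'}$ for all $i\in I$.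 Notation: for $J'\subseteq J$: $C(J')=\sum_{j\in J'}C_j$, $J'^c=J\setminus J'$, $I(J')=\{i\in I:J(i)\subseteq J'\}$, and $I(J'^c)^c=I\setminus I(J\setminus J')=\{i\in I:J(i)\cap J'\neq\emptyset\}$. Connectivity: a pair $(I',J')$ is connected if $J'$ cannot be partitioned into nonempty $J_1,J_2$ such that $I'$ can be partitioned into (possibly empty) $I_1,I_2$ with $J(i)\cap J_2=\emptyset$ for $i\in I_1$ and $J(i)\cap J_1=\emptyset$ for $i\in I_2$. A nonempty $J'\subseteq J$ is connected if $(I,J')$ is connected and strongly connected if $(I(J'),J')$ is connected; $\mathscr{C}(J)$ and $\mathscr{SC}(J)$ are the sets of connected, respectively strongly connected, subsets of $J$. *)

theory Defs
  imports "HOL-Analysis.Analysis"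
begin

text \<open>
  A network with routes of length one. The (finite, nonempty) sets of users and of resources are the
  finite types \<open>'i\<close> and \<open>'j\<close>; \<open>R i\<close> is the set of resources user \<open>i\<close> can use, \<open>C j\<close> the capacity
  of resource \<open>j\<close>, and a state is a vector \<open>n :: real ^ 'i\<close>.
\<close>

text \<open>
  Utilities are extended-real valued on \<open>{0..}\<close> so that both functions that are finite at \<open>0\<close>
  and functions with \<open>U 0 = -\<infinity>\<close>, such as the logarithm, are covered. On \<open>{0<..}\<close> they are
  finite; the value \<open>\<infinity>\<close> at \<open>0\<close> is excluded by monotonicity. Values at negative arguments are irrelevant.
\<close>

definition utility :: "(real \<Rightarrow> ereal) \<Rightarrow> bool" where
  "utility U \<longleftrightarrow>
     (\<forall>x>0. \<bar>U x\<bar> \<noteq> \<infinity>) \<and>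
     strict_mono_on {0..} U \<and>
     (\<forall>x\<ge>0. \<forall>y\<ge>0. \<forall>t. x \<noteq> y \<longrightarrow> 0 < t \<longrightarrow> t < 1 \<longrightarrow>
        ereal (1 - t) * U x + ereal t * U y < U ((1 - t) * x + t * y)) \<and>
     (\<forall>x>0. (\<lambda>y. real_of_ereal (U y)) differentiable (at x))"

definition feasible_allocation ::
  "('j::finite \<Rightarrow> real) \<Rightarrow> ('i::finite \<Rightarrow> 'j set) \<Rightarrow> real ^ 'i \<Rightarrow> real ^ 'i \<Rightarrow> bool" where
  "feasible_allocation C R n x \<longleftrightarrow>
     (\<exists>z :: 'i \<Rightarrow> 'j \<Rightarrow> real.
        (\<forall>j. (\<Sum>i | j \<in> R i. n $ i * z i j) \<le> C j) \<and>
        (\<forall>i. (\<Sum>j\<in>R i. z i j) = x $ i) \<and>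
        (\<forall>i. \<forall>j\<in>R i. 0 \<le> z i j))"

definition aggregate_utility :: "(real \<Rightarrow> ereal) \<Rightarrow> real ^ 'i::finite \<Rightarrow> real ^ 'i \<Rightarrow> ereal" where
  "aggregate_utility U n x = (\<Sum>i\<in>UNIV. ereal (n $ i) * U (x $ i))"

definition optimal_allocation ::
  "(real \<Rightarrow> ereal) \<Rightarrow> ('j::finite \<Rightarrow> real) \<Rightarrow> ('i::finite \<Rightarrow> 'j set) \<Rightarrow> real ^ 'i \<Rightarrow> real ^ 'i \<Rightarrow> bool"
  where
  "optimal_allocation U C R n x \<longleftrightarrow>
     feasible_allocation C R n x \<and>
     (\<forall>y. feasible_allocation C R n y \<longrightarrow> aggregate_utility U n y \<le> aggregate_utility U n x)"

text \<open>
  \<open>the_allocation U C R n x\<close> is the assertion \<open>x = x(n)\<close>: \<open>x\<close> is an optimal allocation in state \<open>n\<close>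
  and the only one. It is a relation, so that nothing is asserted of a default value of a description
  operator. Only the totals are required to be unique, not their split over resources.
\<close>

definition the_allocation ::
  "(real \<Rightarrow> ereal) \<Rightarrow> ('j::finite \<Rightarrow> real) \<Rightarrow> ('i::finite \<Rightarrow> 'j set) \<Rightarrow> real ^ 'i \<Rightarrow> real ^ 'i \<Rightarrow> bool"
  where
  "the_allocation U C R n x \<longleftrightarrow>
     optimal_allocation U C R n x \<and> (\<forall>y. optimal_allocation U C R n y \<longrightarrow> y = x)"

text \<open>
  Equilibria are the positive zeros of the fluid limit
  \<open>n\<^sub>i' = \<lambda>\<^sub>i - \<mu>\<^sub>i n\<^sub>i min (x\<^sub>i(n)) r\<^sub>i\<close>, written with \<open>\<rho>\<^sub>i = \<lambda>\<^sub>i / \<mu>\<^sub>i\<close>.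
\<close>

definition equilibrium_point ::
  "(real \<Rightarrow> ereal) \<Rightarrow> ('j::finite \<Rightarrow> real) \<Rightarrow> ('i::finite \<Rightarrow> 'j set) \<Rightarrow>
   ('i \<Rightarrow> real) \<Rightarrow> ('i \<Rightarrow> real) \<Rightarrow> real ^ 'i \<Rightarrow> bool" where
  "equilibrium_point U C R \<rho> r n \<longleftrightarrow>
     (\<forall>i. 0 < n $ i) \<and>
     (\<exists>x. the_allocation U C R n x \<and> (\<forall>i. n $ i * min (x $ i) (r i) = \<rho> i))"

text \<open>
  The neighbourhood is one in \<open>real ^ 'i\<close>. For a state with positive entries, as every equilibrium
  point is, it can be shrunk to consist of such states.
\<close>

definition complete_resource_pooling ::
  "(real \<Rightarrow> ereal) \<Rightarrow> ('j::finite \<Rightarrow> real) \<Rightarrow> ('i::finite \<Rightarrow> 'j set) \<Rightarrow> real ^ 'i \<Rightarrow> bool" where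
  "complete_resource_pooling U C R n \<longleftrightarrow>
     (\<forall>\<^sub>F n' in nhds n.
        the_allocation U C R n' (\<chi> i. (\<Sum>j\<in>UNIV. C j) / (\<Sum>i'\<in>UNIV. n' $ i')))"

definition confined_users :: "('i \<Rightarrow> 'j set) \<Rightarrow> 'j set \<Rightarrow> 'i set" where
  "confined_users R J' = {i. R i \<subseteq> J'}"

definition connected_pair :: "('i \<Rightarrow> 'j set) \<Rightarrow> 'i set \<Rightarrow> 'j set \<Rightarrow> bool" where
  "connected_pair R I' J' \<longleftrightarrow>
     \<not> (\<exists>J1 J2. J1 \<noteq> {} \<and> J2 \<noteq> {} \<and> J1 \<inter> J2 = {} \<and> J1 \<union> J2 = J' \<and>
          (\<exists>I1 I2. I1 \<inter> I2 = {} \<and> I1 \<union> I2 = I' \<and>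
             (\<forall>i\<in>I1. R i \<inter> J2 = {}) \<and> (\<forall>i\<in>I2. R i \<inter> J1 = {})))"

definition connected_sets :: "('i \<Rightarrow> 'j set) \<Rightarrow> 'j set set" where
  "connected_sets R = {J'. J' \<noteq> {} \<and> connected_pair R UNIV J'}"

definition strongly_connected_sets :: "('i \<Rightarrow> 'j set) \<Rightarrow> 'j set set" where
  "strongly_connected_sets R = {J'. J' \<noteq> {} \<and> connected_pair R (confined_users R J') J'}"

end

theory Submission
  imports Defs
begin

text \<open>
  Choose a common rate \<open>\<theta>\<close> with \<open>\<Sum>\<^sub>i \<rho>\<^sub>i max 1 (\<theta> / r\<^sub>i) = C(J)\<close>, which exists because \<open>\<Sum>\<^sub>i \<rho>\<^sub>i < C(J)\<close>,
  and put \<open>n\<^sub>i = \<rho>\<^sub>i / min \<theta> r\<^sub>i\<close>. Then the demands \<open>w\<^sub>i = n\<^sub>i \<theta>\<close> satisfy \<open>w\<^sub>i \<ge> \<rho>\<^sub>i\<close> and add up to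
  \<open>C(J)\<close>, so the pooling condition, passed to complements, says that the demand confined to a proper
  nonempty \<open>J'\<close> is strictly less than \<open>C(J')\<close>. These strict inequalities persist near \<open>n\<close>, and
  by a fractional Hall theorem they make the equal rates feasible; by Jensen's inequality equal
  rates that exhaust the total capacity are the unique optimum.
\<close>

section \<open>From connected sets to all sets of resources\<close>

lemma not_connected_pairE:
  assumes "\<not> connected_pair R I' J'"
  obtains J1 J2 I1 I2 where "J1 \<noteq> {}" "J2 \<noteq> {}" "J1 \<inter> J2 = {}" "J1 \<union> J2 = J'" "I1 \<union> I2 = I'"
    "\<forall>i\<in>I1. R i \<inter> J2 = {}" "\<forall>i\<in>I2. R i \<inter> J1 = {}"
  using assms unfolding connected_pair_def by metis

text \<open>A disconnected \<open>J'\<close> splits into two smaller sets such that each user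
  confined to \<open>J'\<close> is confined to one of them, and to only one because routes are
  nonempty. Loads and capacities therefore add up, and induction on the cardinality applies. The
  case \<open>J' = UNIV\<close> bounds the total load even if the whole network is not strongly
  connected.\<close>

lemma confined_load_less_capacity:
  fixes C :: "'j::finite \<Rightarrow> real" and R :: "'i::finite \<Rightarrow> 'j set" and \<rho> :: "'i \<Rightarrow> real"
  assumes R: "\<And>i. R i \<noteq> {}" and pos: "\<And>i. 0 \<le> \<rho> i"
    and stable: "\<And>J'. J' \<in> strongly_connected_sets R \<Longrightarrow> sum \<rho> (confined_users R J') < sum C J'"
    and "J' \<noteq> {}"
  shows "sum \<rho> (confined_users R J') < sum C J'"
  using \<open>J' \<noteq> {}\<close>
proof (induction "card J'" arbitrary: J' rule: less_induct)
  case less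
  show ?case
  proof (cases "connected_pair R (confined_users R J') J'")
    case True
    then show ?thesis using less.prems stable by (simp add: strongly_connected_sets_def)
  next
    case False
    then obtain J1 J2 I1 I2 where J: "J1 \<noteq> {}" "J2 \<noteq> {}" "J1 \<inter> J2 = {}" "J1 \<union> J2 = J'"
      and I: "I1 \<union> I2 = confined_users R J'"
      and d: "\<forall>i\<in>I1. R i \<inter> J2 = {}" "\<forall>i\<in>I2. R i \<inter> J1 = {}"
      by (rule not_connected_pairE)
    have card: "card J1 < card J'" "card J2 < card J'"
      by (rule psubset_card_mono; use J in auto)+
    have sub: "confined_users R J' \<subseteq> confined_users R J1 \<union> confined_users R J2"
    proof
      fix i assume i: "i \<in> confined_users R J'"
      then have "R i \<subseteq> J1 \<union> J2" using J(4) by (simp add: confined_users_def)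
      moreover have "R i \<inter> J2 = {} \<or> R i \<inter> J1 = {}" using i I d by auto
      ultimately have "R i \<subseteq> J1 \<or> R i \<subseteq> J2" by auto
      then show "i \<in> confined_users R J1 \<union> confined_users R J2"
        by (simp add: confined_users_def)
    qed
    have disj: "confined_users R J1 \<inter> confined_users R J2 = {}"
    proof (rule equals0I)
      fix i assume "i \<in> confined_users R J1 \<inter> confined_users R J2"
      then have "R i \<subseteq> J1 \<inter> J2" by (simp add: confined_users_def)
      then show False using R[of i] J(3) by simp
    qed
    have "sum \<rho> (confined_users R J') \<le> sum \<rho> (confined_users R J1 \<union> confined_users R J2)"
      using sub pos by (intro sum_mono2) auto
    also have "\<dots> = sum \<rho> (confined_users R J1) + sum \<rho> (confined_users R J2)"
      using disj by (intro sum.union_disjoint) auto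
    also have "\<dots> < sum C J1 + sum C J2"
      using less.hyps card J by (intro add_strict_mono) auto
    also have "\<dots> = sum C J'"
      using J by (subst sum.union_disjoint[symmetric]) auto
    finally show ?thesis .
  qed
qed

text \<open>The set \<open>- confined_users R (- J')\<close> consists of the users whose route meets
  \<open>J'\<close>. If \<open>J'\<close> splits into \<open>J1\<close> and \<open>J2\<close>, no
  route meets both pieces, so these users are the disjoint union of those meeting \<open>J1\<close>
  and those meeting \<open>J2\<close>, and the inequalities for the pieces add up.\<close>

lemma capacity_less_touching_load:
  fixes C :: "'j::finite \<Rightarrow> real" and R :: "'i::finite \<Rightarrow> 'j set" and \<rho> :: "'i \<Rightarrow> real"
  assumes pool: "\<And>J'. J' \<in> connected_sets R \<Longrightarrow> J' \<noteq> UNIV \<Longrightarrow>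
      sum C J' < sum \<rho> (- confined_users R (- J'))"
    and "J' \<noteq> {}" "J' \<noteq> UNIV"
  shows "sum C J' < sum \<rho> (- confined_users R (- J'))"
  using \<open>J' \<noteq> {}\<close> \<open>J' \<noteq> UNIV\<close>
proof (induction "card J'" arbitrary: J' rule: less_induct)
  case less
  show ?case
  proof (cases "connected_pair R UNIV J'")
    case True
    then show ?thesis using less.prems pool by (simp add: connected_sets_def)
  next
    case False
    then obtain J1 J2 I1 I2 where J: "J1 \<noteq> {}" "J2 \<noteq> {}" "J1 \<inter> J2 = {}" "J1 \<union> J2 = J'"
      and I: "I1 \<union> I2 = UNIV"
      and d: "\<forall>i\<in>I1. R i \<inter> J2 = {}" "\<forall>i\<in>I2. R i \<inter> J1 = {}"
      by (rule not_connected_pairE)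
    let ?T = "\<lambda>J. - confined_users R (- J)"
    have card: "card J1 < card J'" "card J2 < card J'"
      by (rule psubset_card_mono; use J in auto)+
    have neq: "J1 \<noteq> UNIV" "J2 \<noteq> UNIV"
      using J by auto
    have un: "?T J' = ?T J1 \<union> ?T J2"
      using J(4) unfolding confined_users_def by blast
    have disj: "?T J1 \<inter> ?T J2 = {}"
      using I d unfolding confined_users_def by blast
    have "sum C J' = sum C J1 + sum C J2"
      using J by (subst sum.union_disjoint[symmetric]) auto
    also have "\<dots> < sum \<rho> (?T J1) + sum \<rho> (?T J2)"
      using less.hyps card J neq by (intro add_strict_mono) auto
    also have "\<dots> = sum \<rho> (?T J')"
      unfolding un using disj by (intro sum.union_disjoint[symmetric]) auto
    finally show ?thesis .
  qed
qed

section \<open>Feasibility of given demands\<close>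

text \<open>
  The flow minimizing the sum of the squared deficits \<open>w\<^sub>i - \<Sum>\<^sub>j z\<^sub>i\<^sub>j\<close>
  leaves no positive deficit: capacity usable by a user in deficit is exhausted, and exhausted only
  by users whose deficit is at least as large, so these users together violate the hypothesis.
\<close>

lemma fractional_hall:
  fixes C :: "'j::finite \<Rightarrow> real" and R :: "'i::finite \<Rightarrow> 'j set" and w :: "'i \<Rightarrow> real"
  assumes C: "\<And>j. 0 \<le> C j" and w: "\<And>i. 0 < w i"
    and hall: "\<And>J'. sum w (confined_users R J') \<le> sum C J'"
  obtains z where "\<And>i j. 0 \<le> z i j" "\<And>i. (\<Sum>j\<in>R i. z i j) = w i"
    "\<And>j. (\<Sum>i | j \<in> R i. z i j) \<le> C j"
proof -
  \<comment> \<open>Flows vanish off the routes, so sums can run over whole types and the flows form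
    a compact subset of a Euclidean space. The deficit \<open>s z i\<close> is negative for a user
    that gets more than \<open>w i\<close>.\<close>
  define Z :: "(real^'j^'i) set" where
    "Z = {z. (\<forall>i j. 0 \<le> z $ i $ j) \<and> (\<forall>i j. j \<notin> R i \<longrightarrow> z $ i $ j = 0) \<and>
             (\<forall>j. (\<Sum>i\<in>UNIV. z $ i $ j) \<le> C j)}"
  define s :: "real^'j^'i \<Rightarrow> 'i \<Rightarrow> real" where "s z i = w i - (\<Sum>j\<in>UNIV. z $ i $ j)" for z i
  have "closed Z"
    unfolding Z_def
    by (intro closed_Collect_conj closed_Collect_all closed_Collect_le closed_Collect_imp
        closed_Collect_eq continuous_intros open_Collect_const)
  moreover have "bounded Z"
  proof -
    have "norm z \<le> (\<Sum>i\<in>(UNIV::'i set). \<Sum>j\<in>UNIV. C j)" if "z \<in> Z" for z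
    proof -
      have "norm (z $ i $ j) \<le> C j" for i j
      proof -
        have "z $ i $ j \<le> (\<Sum>i\<in>UNIV. z $ i $ j)"
          using that by (intro member_le_sum) (auto simp: Z_def)
        also have "\<dots> \<le> C j" using that by (auto simp: Z_def)
        finally show ?thesis using that by (auto simp: Z_def)
      qed
      then have "norm (z $ i) \<le> (\<Sum>j\<in>UNIV. C j)" for i
        by (intro order_trans[OF norm_le_l1_cart] sum_mono) auto
      moreover have "norm z \<le> (\<Sum>i\<in>UNIV. norm (z $ i))"
        unfolding norm_vec_def by (rule L2_set_le_sum) auto
      ultimately show ?thesis by (meson order_trans sum_mono)
    qed
    then show ?thesis unfolding bounded_iff by blast
  qed
  ultimately have "compact Z" by (simp add: compact_eq_bounded_closed)
  moreover have "0 \<in> Z" by (auto simp: Z_def C)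
  moreover have "continuous_on Z (\<lambda>z. \<Sum>i\<in>UNIV. (s z i)\<^sup>2)"
    unfolding s_def by (intro continuous_intros)
  ultimately have "\<exists>z\<in>Z. \<forall>y\<in>Z. (\<Sum>i\<in>UNIV. (s z i)\<^sup>2) \<le> (\<Sum>i\<in>UNIV. (s y i)\<^sup>2)"
    by (intro continuous_attains_inf) auto
  then obtain z where z: "z \<in> Z"
    and min: "\<And>y. y \<in> Z \<Longrightarrow> (\<Sum>i\<in>UNIV. (s z i)\<^sup>2) \<le> (\<Sum>i\<in>UNIV. (s y i)\<^sup>2)"
    by blast
  have z0: "0 \<le> z $ i $ j" and zR: "j \<notin> R i \<Longrightarrow> z $ i $ j = 0"
    and zC: "(\<Sum>i\<in>UNIV. z $ i $ j) \<le> C j" for i j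
    using z by (auto simp: Z_def)
  have full: "(\<Sum>i\<in>UNIV. z $ i $ j) = C j" if i: "s z i > 0" and j: "j \<in> R i" for i j
  proof (rule ccontr)
    assume "(\<Sum>i\<in>UNIV. z $ i $ j) \<noteq> C j"
    then have slack: "C j - (\<Sum>i\<in>UNIV. z $ i $ j) > 0" using zC[of j] by simp
    \<comment> \<open>User \<open>i\<close> receives \<open>e\<close> more units of
      \<open>j\<close>. Capping \<open>e\<close> by the slack keeps the flow in \<open>Z\<close>;
      capping it by the deficit keeps the new deficit nonnegative, so its square drops.\<close>
    define e where "e = min (s z i) (C j - (\<Sum>i\<in>UNIV. z $ i $ j))"
    have e: "e > 0" "e \<le> s z i" "e \<le> C j - (\<Sum>i\<in>UNIV. z $ i $ j)"
      using i slack by (auto simp: e_def)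
    define y :: "real^'j^'i" where
      "y = (\<chi> k l. z $ k $ l + (if k = i then if l = j then e else 0 else 0))"
    have "(\<Sum>k\<in>UNIV. y $ k $ l) = (\<Sum>k\<in>UNIV. z $ k $ l) + (if l = j then e else 0)" for l
      by (simp add: y_def sum.distrib)
    then have "y \<in> Z"
      using e z0 zR zC j by (auto simp: Z_def) (auto simp: y_def)
    have sy: "s y k = s z k - (if k = i then e else 0)" for k
      by (simp add: s_def y_def sum.distrib)
    have "(\<Sum>k\<in>UNIV. (s y k)\<^sup>2) < (\<Sum>k\<in>UNIV. (s z k)\<^sup>2)"
    proof (rule sum_strict_mono_ex1)
      show "\<forall>k\<in>UNIV. (s y k)\<^sup>2 \<le> (s z k)\<^sup>2"
        using e by (auto simp: sy intro!: power_mono)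
      show "\<exists>k\<in>UNIV. (s y k)\<^sup>2 < (s z k)\<^sup>2"
        using e by (intro bexI[of _ i]) (auto simp: sy intro!: power_strict_mono)
    qed simp
    then show False using min[OF \<open>y \<in> Z\<close>] by simp
  qed
  have larger: "s z i \<le> s z k" if j: "j \<in> R i" and k: "z $ k $ j > 0" for i j k
  proof (rule ccontr)
    assume "\<not> s z i \<le> s z k"
    then have less: "s z k < s z i" by simp
    then have ik: "i \<noteq> k" by auto
    \<comment> \<open>Moving \<open>e\<close> units of \<open>j\<close> from \<open>k\<close> to
      \<open>i\<close> leaves every load on a resource unchanged and changes the objective by
      \<open>2 * e * (e - (s z i - s z k))\<close>. Half the gap between the deficits makes this
      negative.\<close>
    define e where "e = min (z $ k $ j) ((s z i - s z k) / 2)"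
    have e: "e > 0" "e \<le> z $ k $ j" "e \<le> (s z i - s z k) / 2"
      using less k unfolding e_def by (simp_all only: min.cobounded1 min.cobounded2) simp
    define d where "d l = (if l = i then e else 0) - (if l = k then e else 0)" for l
    define y :: "real^'j^'i" where "y = (\<chi> l m. z $ l $ m + (if m = j then d l else 0))"
    have d: "(\<Sum>l\<in>UNIV. d l) = 0" by (simp add: d_def sum_subtractf)
    have "(\<Sum>l\<in>UNIV. y $ l $ m) = (\<Sum>l\<in>UNIV. z $ l $ m)" for m
      by (cases "m = j") (simp_all add: y_def sum.distrib d)
    moreover have "0 \<le> y $ l $ m" for l m
      using e z0[of l m] by (auto simp: y_def d_def)
    moreover have "y $ l $ m = 0" if "m \<notin> R l" for l m
      using that zR[of m l] j k by (auto simp: y_def d_def)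
    ultimately have "y \<in> Z" using zC by (simp add: Z_def)
    have sy: "s y l = s z l - d l" for l
      by (simp add: s_def y_def sum.distrib)
    have "(s y l)\<^sup>2 = (s z l)\<^sup>2 + (if l = i then e\<^sup>2 - 2 * e * s z i else 0)
        + (if l = k then e\<^sup>2 + 2 * e * s z k else 0)" for l
      using ik by (auto simp: sy d_def power2_eq_square algebra_simps)
    then have "(\<Sum>l\<in>UNIV. (s y l)\<^sup>2) =
        (\<Sum>l\<in>UNIV. (s z l)\<^sup>2) + 2 * e * (e - (s z i - s z k))"
      by (simp add: sum.distrib power2_eq_square algebra_simps)
    moreover have "e * (e - (s z i - s z k)) < 0"
      using e less by (intro mult_pos_neg) auto
    ultimately show False using min[OF \<open>y \<in> Z\<close>] by simp
  qed
  have row: "(\<Sum>j\<in>UNIV. z $ i $ j) = (\<Sum>j\<in>R i. z $ i $ j)" for i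
    by (rule sum.mono_neutral_right) (auto simp: zR)
  have no_deficit: "s z i \<le> 0" for i
  proof (rule ccontr)
    assume "\<not> s z i \<le> 0"
    define A where "A = {i. s z i > 0}"
    define J' where "J' = (\<Union>i\<in>A. R i)"
    have "i \<in> A" using \<open>\<not> s z i \<le> 0\<close> by (simp add: A_def)
    have col: "C j = (\<Sum>i\<in>A. z $ i $ j)" if jJ: "j \<in> J'" for j
    proof -
      obtain a where a: "a \<in> A" "j \<in> R a" using jJ by (auto simp: J'_def)
      have "C j = (\<Sum>i\<in>UNIV. z $ i $ j)" using full a by (simp add: A_def)
      also have "\<dots> = (\<Sum>i\<in>A. z $ i $ j)"
      proof (rule sum.mono_neutral_right; safe?)
        fix k assume "k \<notin> A"
        then have "\<not> z $ k $ j > 0" using larger[of j a k] a by (auto simp: A_def)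
        then show "z $ k $ j = 0" using z0[of k j] by simp
      qed auto
      finally show ?thesis .
    qed
    have "sum C J' = (\<Sum>j\<in>J'. \<Sum>i\<in>A. z $ i $ j)" by (simp add: col)
    also have "\<dots> = (\<Sum>i\<in>A. \<Sum>j\<in>J'. z $ i $ j)" by (rule sum.swap)
    also have "\<dots> \<le> (\<Sum>i\<in>A. \<Sum>j\<in>UNIV. z $ i $ j)"
      by (intro sum_mono sum_mono2) (auto simp: z0)
    also have "\<dots> < sum w A"
      using \<open>i \<in> A\<close> by (intro sum_strict_mono) (auto simp: A_def s_def)
    also have "\<dots> \<le> sum w (confined_users R J')"
      using w by (intro sum_mono2) (auto simp: confined_users_def J'_def less_imp_le)
    also have "\<dots> \<le> sum C J'" by (rule hall)
    finally show False by simp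
  qed
  \<comment> \<open>The minimizer is only known to give each user at least \<open>w i\<close>.
    Scaling the flow of user \<open>i\<close> by \<open>w i / row i\<close>, a factor at most 1,
    meets the demand exactly and respects the capacities.\<close>
  define row where "row i = (\<Sum>j\<in>R i. z $ i $ j)" for i
  have ge: "w i \<le> row i" for i
    using no_deficit[of i] by (simp add: s_def row row_def)
  show ?thesis
  proof (rule that[of "\<lambda>i j. z $ i $ j * (w i / row i)"])
    show "0 \<le> z $ i $ j * (w i / row i)" for i j
      using z0[of i j] w[of i] ge[of i] by simp
    show "(\<Sum>j\<in>R i. z $ i $ j * (w i / row i)) = w i" for i
      using w[of i] ge[of i] unfolding sum_distrib_right[symmetric] row_def[symmetric] by simp
    have "z $ i $ j * (w i / row i) \<le> z $ i $ j" for i j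
      using z0[of i j] w[of i] ge[of i] by (intro mult_left_le) auto
    then have "(\<Sum>i | j \<in> R i. z $ i $ j * (w i / row i)) \<le> (\<Sum>i | j \<in> R i. z $ i $ j)" for j
      by (intro sum_mono)
    also have "(\<Sum>i | j \<in> R i. z $ i $ j) \<le> (\<Sum>i\<in>UNIV. z $ i $ j)" for j
      by (intro sum_mono2) (auto simp: z0)
    also have "(\<Sum>i\<in>UNIV. z $ i $ j) \<le> C j" for j by (rule zC)
    finally show "(\<Sum>i | j \<in> R i. z $ i $ j * (w i / row i)) \<le> C j" for j .
  qed
qed

section \<open>Optimality of equal rates\<close>

text \<open>This is the tangent inequality behind the Jensen argument, in a form that includes
  \<open>y = 0\<close>, where \<open>U\<close> may be infinite. The slope is nonnegative because
  \<open>U\<close> increases from \<open>x\<close> to \<open>2 * x\<close>.\<close>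

lemma utility_below_tangent:
  assumes U: "utility U" and x: "0 < x"
  obtains D where "0 \<le> D"
    and "\<And>y. 0 \<le> y \<Longrightarrow> y \<noteq> x \<Longrightarrow> U y < ereal (real_of_ereal (U x) + D * (y - x))"
proof -
  define u where "u = (\<lambda>y. real_of_ereal (U y))"
  have Uu: "U y = ereal (u y)" if "0 < y" for y
    using U that by (auto simp: utility_def u_def ereal_real)
  have conc: "ereal (1 - t) * U a + ereal t * U b < U ((1 - t) * a + t * b)"
    if "0 \<le> a" "0 \<le> b" "a \<noteq> b" "0 < t" "t < 1" for a b t
    using U that by (auto simp: utility_def)
  obtain D where D: "(u has_real_derivative D) (at x)"
    using U x by (auto simp: utility_def u_def real_differentiable_def)
  have convex: "convex_on {0<..} (\<lambda>y. - u y)"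
  proof (rule convex_onI)
    fix t a b :: real assume t: "0 < t" "t < 1" and ab: "a \<in> {0<..}" "b \<in> {0<..}"
    show "- u ((1 - t) *\<^sub>R a + t *\<^sub>R b) \<le> (1 - t) * - u a + t * - u b"
    proof (cases "a = b")
      case True
      then show ?thesis by (simp add: algebra_simps)
    next
      case False
      have "0 < (1 - t) * a + t * b" using t ab by (simp add: add_pos_pos)
      then show ?thesis using conc[of a b t] False t ab by (simp add: Uu)
    qed
  qed simp
  have tangent: "u y \<le> u x + D * (y - x)" if "0 < y" for y
  proof -
    have "((\<lambda>y. - u y) has_real_derivative - D) (at x within {0<..})"
      using DERIV_minus[OF D] by (rule has_field_derivative_at_within)
    moreover have "x \<in> interior {0<..}" "y \<in> {0<..}"
      using that x by (auto simp: interior_open)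
    ultimately have "- D * (y - x) \<le> - u y - - u x"
      by (intro convex_on_imp_above_tangent[OF convex]) auto
    then show ?thesis by simp
  qed
  have "U x < U (2 * x)"
    using U x by (auto simp: utility_def strict_mono_on_def)
  then have "0 \<le> D"
    using tangent[of "2 * x"] x by (simp add: Uu) (smt (verit) mult_neg_pos)
  moreover have "U y < ereal (u x + D * (y - x))" if y: "0 \<le> y" "y \<noteq> x" for y
  proof -
    \<comment> \<open>The midpoint of \<open>y\<close> and \<open>x\<close> is positive even for
      \<open>y = 0\<close>, so the weak tangent bound holds there; strict concavity carries it back
      to \<open>y\<close> as a strict bound.\<close>
    have mid: "0 < (1 - 1/2) * y + 1/2 * x" using x y by simp
    have "ereal (1 - 1/2) * U y + ereal (1/2) * U x < U ((1 - 1/2) * y + 1/2 * x)"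
      using x y by (intro conc) auto
    also have "\<dots> = ereal (u ((1 - 1/2) * y + 1/2 * x))"
      using mid by (rule Uu)
    also have "\<dots> \<le> ereal (u x + D * (((1 - 1/2) * y + 1/2 * x) - x))"
      using tangent[OF mid] by simp
    finally show ?thesis
      using x by (cases "U y") (auto simp: Uu field_simps)
  qed
  ultimately show ?thesis using that by (simp add: u_def)
qed

lemma feasible_allocation_nonneg:
  assumes "feasible_allocation C R n x"
  shows "0 \<le> x $ i"
  using assms unfolding feasible_allocation_def by (metis sum_nonneg)

lemma feasible_allocation_total:
  fixes C :: "'j::finite \<Rightarrow> real" and n :: "real ^ 'i::finite"
  assumes "feasible_allocation C R n x"
  shows "(\<Sum>i\<in>UNIV. n $ i * x $ i) \<le> sum C UNIV"
proof -
  obtain z where z: "\<And>j. (\<Sum>i | j \<in> R i. n $ i * z i j) \<le> C j" "\<And>i. (\<Sum>j\<in>R i. z i j) = x $ i"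
    using assms unfolding feasible_allocation_def by blast
  have "(\<Sum>i\<in>UNIV. n $ i * x $ i) = (\<Sum>i\<in>UNIV. \<Sum>j\<in>{j. j \<in> UNIV \<and> j \<in> R i}. n $ i * z i j)"
    by (simp add: z(2)[symmetric] sum_distrib_left)
  also have "\<dots> = (\<Sum>j\<in>UNIV. \<Sum>i\<in>{i. i \<in> UNIV \<and> j \<in> R i}. n $ i * z i j)"
    by (rule sum.swap_restrict) auto
  also have "\<dots> \<le> sum C UNIV"
    using z(1) by (intro sum_mono) auto
  finally show ?thesis .
qed

text \<open>The tangent inequalities at \<open>x\<close>, weighted by \<open>n $ i\<close>, are
  summed. Since equal rates use up the total capacity, no feasible \<open>y\<close> has a larger
  weighted total, so the linear term is at most 0. Strictness in a coordinate that differs from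
  \<open>x\<close> gives uniqueness.\<close>

lemma the_allocation_equal_rates:
  fixes C :: "'j::finite \<Rightarrow> real" and n :: "real ^ 'i::finite"
  assumes U: "utility U" and n: "\<And>i. 0 < n $ i" and "0 < x"
    and total: "(\<Sum>i\<in>UNIV. n $ i) * x = sum C UNIV"
    and feas: "feasible_allocation C R n (\<chi> i. x)"
  shows "the_allocation U C R n (\<chi> i. x)"
proof -
  obtain D where D: "0 \<le> D"
    and below: "\<And>y. 0 \<le> y \<Longrightarrow> y \<noteq> x \<Longrightarrow> U y < ereal (real_of_ereal (U x) + D * (y - x))"
    using utility_below_tangent[OF U \<open>0 < x\<close>] by metis
  define u where "u = real_of_ereal (U x)"
  have Ux: "U x = ereal u"
    using U \<open>0 < x\<close> by (auto simp: utility_def u_def ereal_real)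
  have less: "aggregate_utility U n y < aggregate_utility U n (\<chi> i. x)"
    if y: "feasible_allocation C R n y" "y \<noteq> (\<chi> i. x)" for y
  proof -
    \<comment> \<open>\<open>U (y $ i)\<close> may be minus infinity. A real \<open>v\<close>
      between it and the tangent value moves the strict comparison of sums into the reals.\<close>
    have "\<exists>v. U (y $ i) \<le> ereal v \<and> v \<le> u + D * (y $ i - x) \<and>
        (y $ i \<noteq> x \<longrightarrow> v < u + D * (y $ i - x))" for i
    proof (cases "y $ i = x")
      case True
      then show ?thesis by (auto simp: Ux)
    next
      case False
      then have "U (y $ i) < ereal (u + D * (y $ i - x))"
        using below feasible_allocation_nonneg[OF y(1)] by (simp add: u_def)
      then show ?thesis
        by (metis ereal_dense2 ereal_less_eq(3) less_ereal.simps(1) less_imp_le)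
    qed
    then obtain v where v: "\<And>i. U (y $ i) \<le> ereal (v i)" "\<And>i. v i \<le> u + D * (y $ i - x)"
      "\<And>i. y $ i \<noteq> x \<Longrightarrow> v i < u + D * (y $ i - x)"
      by metis
    have "aggregate_utility U n y \<le> (\<Sum>i\<in>UNIV. ereal (n $ i * v i))"
      unfolding aggregate_utility_def times_ereal.simps(1)[symmetric]
      using n v(1) by (intro sum_mono ereal_mult_left_mono) (auto simp: less_imp_le)
    also have "\<dots> = ereal (\<Sum>i\<in>UNIV. n $ i * v i)"
      by simp
    also have "\<dots> < ereal (\<Sum>i\<in>UNIV. n $ i * (u + D * (y $ i - x)))"
    proof -
      obtain i where "y $ i \<noteq> x" using y(2) by (auto simp: vec_eq_iff)
      then have "(\<Sum>i\<in>UNIV. n $ i * v i) < (\<Sum>i\<in>UNIV. n $ i * (u + D * (y $ i - x)))"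
        using n v by (intro sum_strict_mono_ex1) (auto simp: less_imp_le intro: exI[of _ i])
      then show ?thesis by simp
    qed
    also have "(\<Sum>i\<in>UNIV. n $ i * (u + D * (y $ i - x))) =
        (\<Sum>i\<in>UNIV. n $ i * u) + D * ((\<Sum>i\<in>UNIV. n $ i * y $ i) - (\<Sum>i\<in>UNIV. n $ i) * x)"
      by (simp add: sum.distrib sum_subtractf sum_distrib_left sum_distrib_right algebra_simps)
    also have "ereal \<dots> \<le> ereal (\<Sum>i\<in>UNIV. n $ i * u)"
      using D feasible_allocation_total[OF y(1)] by (simp add: total mult_nonneg_nonpos)
    also have "\<dots> = aggregate_utility U n (\<chi> i. x)"
      by (simp add: aggregate_utility_def Ux)
    finally show ?thesis .
  qed
  show ?thesis
    unfolding the_allocation_def optimal_allocation_def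
    using feas less by (metis less_imp_le linorder_not_less order_refl)
qed

section \<open>Pooled allocations and their stability under perturbation\<close>

text \<open>The Hall condition also covers the two sets left out of \<open>pool\<close>: no user is
  confined to the empty set, and for \<open>UNIV\<close> equality holds by the choice of the rate.
  The state is an arbitrary positive one, so that perturbed states are covered too.\<close>

lemma the_allocation_pooled:
  fixes C :: "'j::finite \<Rightarrow> real" and R :: "'i::finite \<Rightarrow> 'j set" and n :: "real ^ 'i"
  assumes C: "\<And>j. 0 < C j" and R: "\<And>i. R i \<noteq> {}" and U: "utility U"
    and n: "\<And>i. 0 < n $ i"
    and pool: "\<And>J'. J' \<noteq> {} \<Longrightarrow> J' \<noteq> UNIV \<Longrightarrow>
      (\<Sum>i\<in>confined_users R J'. n $ i * (sum C UNIV / (\<Sum>i\<in>UNIV. n $ i))) < sum C J'"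
  shows "the_allocation U C R n (\<chi> i. sum C UNIV / (\<Sum>i\<in>UNIV. n $ i))"
proof -
  define x where "x = sum C UNIV / (\<Sum>i\<in>UNIV. n $ i)"
  have "0 < (\<Sum>i\<in>UNIV. n $ i)" "0 < sum C UNIV"
    by (intro sum_pos; simp add: n C)+
  then have x: "0 < x" and total: "(\<Sum>i\<in>UNIV. n $ i) * x = sum C UNIV"
    by (simp_all add: x_def)
  have "(\<Sum>i\<in>confined_users R J'. n $ i * x) \<le> sum C J'" for J'
  proof -
    consider "J' = {}" | "J' = UNIV" | "J' \<noteq> {}" "J' \<noteq> UNIV" by blast
    then show ?thesis
    proof cases
      case 1
      then have "confined_users R J' = {}" using R by (auto simp: confined_users_def)
      then show ?thesis using 1 by simp
    next
      case 2
      then show ?thesis using total by (simp add: confined_users_def sum_distrib_right)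
    next
      case 3
      then show ?thesis using pool[of J'] by (simp add: x_def)
    qed
  qed
  then obtain z where z: "\<And>i j. 0 \<le> z i j" "\<And>i. (\<Sum>j\<in>R i. z i j) = n $ i * x"
    "\<And>j. (\<Sum>i | j \<in> R i. z i j) \<le> C j"
    using fractional_hall[of C "\<lambda>i. n $ i * x" R] C n x by (metis less_imp_le mult_pos_pos)
  have "feasible_allocation C R n (\<chi> i. x)"
    unfolding feasible_allocation_def
  \<comment> \<open>\<open>z\<close> is the flow of a whole user class; division by
    \<open>n $ i\<close> gives the rate per flow.\<close>
  proof (intro exI[of _ "\<lambda>i j. z i j / n $ i"] conjI allI ballI)
    show "(\<Sum>i | j \<in> R i. n $ i * (z i j / n $ i)) \<le> C j" for j
      using z(3)[of j] n by (simp add: less_imp_neq[THEN not_sym])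
    show "(\<Sum>j\<in>R i. z i j / n $ i) = (\<chi> i. x) $ i" for i
      using n[of i] by (simp add: sum_divide_distrib[symmetric] z(2))
    show "0 \<le> z i j / n $ i" for i j
      using n[of i] z(1) by simp
  qed
  then show ?thesis
    using the_allocation_equal_rates[OF U n x total] by (simp add: x_def)
qed

text \<open>The assumptions on \<open>n\<close> are finitely many strict inequalities between
  functions continuous at \<open>n\<close>, so they hold throughout a neighbourhood.\<close>

lemma complete_resource_poolingI:
  fixes C :: "'j::finite \<Rightarrow> real" and R :: "'i::finite \<Rightarrow> 'j set" and n :: "real ^ 'i"
  assumes C: "\<And>j. 0 < C j" and R: "\<And>i. R i \<noteq> {}" and U: "utility U"
    and n: "\<And>i. 0 < n $ i"
    and pool: "\<And>J'. J' \<noteq> {} \<Longrightarrow> J' \<noteq> UNIV \<Longrightarrow>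
      (\<Sum>i\<in>confined_users R J'. n $ i * (sum C UNIV / (\<Sum>i\<in>UNIV. n $ i))) < sum C J'"
  shows "complete_resource_pooling U C R n"
proof -
  have "0 < (\<Sum>i\<in>UNIV. n $ i)"
    by (intro sum_pos) (simp_all add: n)
  then have lim: "((\<lambda>m. \<Sum>i\<in>I. m $ i * (sum C UNIV / (\<Sum>i\<in>UNIV. m $ i))) \<longlongrightarrow>
      (\<Sum>i\<in>I. n $ i * (sum C UNIV / (\<Sum>i\<in>UNIV. n $ i)))) (nhds n)" for I
    by (intro tendsto_intros filterlim_ident) auto
  have "\<forall>\<^sub>F m in nhds n. 0 < m $ i" for i
    using order_tendstoD(1)[OF tendsto_vec_nth[OF filterlim_ident] n] .
  then have "\<forall>\<^sub>F m in nhds n. \<forall>i. 0 < m $ i"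
    by (rule eventually_all_finite)
  moreover have "\<forall>\<^sub>F m in nhds n. J' \<noteq> {} \<longrightarrow> J' \<noteq> UNIV \<longrightarrow>
      (\<Sum>i\<in>confined_users R J'. m $ i * (sum C UNIV / (\<Sum>i\<in>UNIV. m $ i))) < sum C J'" for J'
    using order_tendstoD(2)[OF lim pool[of J']] by (cases "J' = {} \<or> J' = UNIV") auto
  then have "\<forall>\<^sub>F m in nhds n. \<forall>J'. J' \<noteq> {} \<longrightarrow> J' \<noteq> UNIV \<longrightarrow>
      (\<Sum>i\<in>confined_users R J'. m $ i * (sum C UNIV / (\<Sum>i\<in>UNIV. m $ i))) < sum C J'"
    by (rule eventually_all_finite)
  ultimately show ?thesis
    unfolding complete_resource_pooling_def
    by eventually_elim (rule the_allocation_pooled[of C R U, OF C R U]; blast)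
qed

section \<open>Construction of the equilibrium\<close>

theorem theorem5p8:
  fixes C :: "'j::finite \<Rightarrow> real"
    and R :: "'i::finite \<Rightarrow> 'j set"
    and lam mu r \<rho> :: "'i \<Rightarrow> real"
    and U :: "real \<Rightarrow> ereal"
  assumes "\<And>j. 0 < C j"
    and "\<And>i. R i \<noteq> {}"
    and "\<And>i. 0 < lam i"
    and "\<And>i. 0 < mu i"
    and "\<And>i. 0 < r i"
    and "\<And>i. \<rho> i = lam i / mu i"
    and "utility U"
    and "\<And>J'. J' \<in> strongly_connected_sets R \<Longrightarrow>
           (\<Sum>i\<in>confined_users R J'. \<rho> i) < (\<Sum>j\<in>J'. C j)"
    and "\<And>J'. J' \<in> connected_sets R \<Longrightarrow> J' \<noteq> UNIV \<Longrightarrow>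
           (\<Sum>j\<in>J'. C j) < (\<Sum>i\<in>- confined_users R (- J'). \<rho> i)"
  shows "\<exists>n :: real ^ 'i. equilibrium_point U C R \<rho> r n \<and> complete_resource_pooling U C R n"
proof -
  note C = assms(1) and R = assms(2) and r = assms(5)
  have \<rho>: "0 < \<rho> i" for i using assms(3,4,6) by simp
  \<comment> \<open>\<open>g t\<close> is the total demand at common rate \<open>t\<close> when
    class \<open>i\<close> has \<rho> i / min t (r i) flows. At \<open>t = 0\<close> it is the total
    of \<rho>, since division by \<open>r i\<close> gives 0 there.\<close>
  define g where "g t = (\<Sum>i\<in>UNIV. \<rho> i * max 1 (t / r i))" for t
  have g0: "g 0 < sum C UNIV"
    using confined_load_less_capacity[of R \<rho> C UNIV] R \<rho> assms(8)
    by (simp add: g_def confined_users_def less_imp_le)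
  obtain T where T: "0 \<le> T" "sum C UNIV \<le> g T"
  proof -
    obtain k :: 'i where True by simp
    \<comment> \<open>At this rate the term \<open>t / r k\<close> of the single user
      \<open>k\<close> alone already accounts for the whole capacity.\<close>
    define T where "T = r k * sum C UNIV / \<rho> k"
    have "sum C UNIV = \<rho> k * (T / r k)"
      using \<rho>[of k] r[of k] by (simp add: T_def)
    also have "\<dots> \<le> \<rho> k * max 1 (T / r k)"
      using \<rho>[of k] by (intro mult_left_mono) auto
    also have "\<dots> \<le> g T"
      unfolding g_def using \<rho> by (intro member_le_sum) (auto simp: less_imp_le)
    finally have "sum C UNIV \<le> g T" .
    moreover have "0 \<le> T"
      using \<rho>[of k] r[of k] C by (simp add: T_def sum_nonneg less_imp_le)
    ultimately show ?thesis using that by blast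
  qed
  have "continuous_on {0..T} g"
    unfolding g_def using r
    by (intro continuous_intros) (auto simp: less_imp_neq[THEN not_sym])
  then obtain \<theta> where \<theta>: "0 \<le> \<theta>" "g \<theta> = sum C UNIV"
    using IVT'[of g 0 "sum C UNIV" T] g0 T by auto
  have "0 < \<theta>" using g0 \<theta> by (cases "\<theta> = 0") auto
  define n :: "real ^ 'i" where "n = (\<chi> i. \<rho> i / min \<theta> (r i))"
  have n: "0 < n $ i" for i using \<rho> r \<open>0 < \<theta>\<close> by (simp add: n_def)
  have load: "n $ i * \<theta> = \<rho> i * max 1 (\<theta> / r i)" for i
    using r[of i] \<open>0 < \<theta>\<close> by (auto simp: n_def min_def max_def field_simps)
  have tot: "(\<Sum>i\<in>UNIV. n $ i * \<theta>) = sum C UNIV"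
    using \<theta> by (simp add: load g_def)
  have "0 < (\<Sum>i\<in>UNIV. n $ i)" by (intro sum_pos) (simp_all add: n)
  then have rate: "sum C UNIV / (\<Sum>i\<in>UNIV. n $ i) = \<theta>"
    by (simp add: tot[symmetric] sum_distrib_right[symmetric])
  have pool: "(\<Sum>i\<in>confined_users R J'. n $ i * \<theta>) < sum C J'" if J': "J' \<noteq> {}" "J' \<noteq> UNIV" for J'
  proof -
    \<comment> \<open>Users not confined to \<open>J'\<close> are those meeting \<open>- J'\<close>.
      Their demand exceeds the capacity of \<open>- J'\<close>, and subtraction from the equal
      totals bounds the demand confined to \<open>J'\<close>.\<close>
    have "sum C (- J') < sum \<rho> (- confined_users R J')"
      using capacity_less_touching_load[of R C \<rho> "- J'"] assms(9) J' by auto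
    also have "\<dots> \<le> (\<Sum>i\<in>- confined_users R J'. n $ i * \<theta>)"
      unfolding load using \<rho> by (intro sum_mono) (auto simp: less_imp_le)
    finally have "sum C (- J') < (\<Sum>i\<in>- confined_users R J'. n $ i * \<theta>)" .
    moreover have "sum C UNIV = sum C J' + sum C (- J')"
      by (simp add: sum.union_disjoint[symmetric])
    moreover have "(\<Sum>i\<in>UNIV. n $ i * \<theta>) =
        (\<Sum>i\<in>confined_users R J'. n $ i * \<theta>) + (\<Sum>i\<in>- confined_users R J'. n $ i * \<theta>)"
      by (simp add: sum.union_disjoint[symmetric])
    ultimately show ?thesis using tot by linarith
  qed
  have "the_allocation U C R n (\<chi> i. \<theta>)"
    using the_allocation_pooled[of C R U n, OF C R assms(7) n] pool by (simp add: rate)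
  moreover have "n $ i * min \<theta> (r i) = \<rho> i" for i
    using r[of i] \<open>0 < \<theta>\<close> by (simp add: n_def)
  ultimately have "equilibrium_point U C R \<rho> r n"
    unfolding equilibrium_point_def using n by (intro conjI allI exI[of _ "\<chi> i. \<theta>"]) auto
  moreover have "complete_resource_pooling U C R n"
    using C R assms(7) n by (rule complete_resource_poolingI[of C R U n]) (simp add: rate pool)
  ultimately show ?thesis by blast
qed

end
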